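(* Let $P\in\mathbb{C}[z]$ be a monic polynomial of degree $d\geq 1$ and let $z_0\in\mathbb{C}$ satisfy $$|P(z_0)| > \max |P(\mathrm{Crit}(P))| \qquad\text{and}\qquad \arg P(z_0)\notin \arg\left[P(\mathrm{Crit}(P))\setminus\{0\}\right].$$ Let $t_0\in\mathbb{R}$ and let $\lambda$ be the maximal solution of $\lambda'(t)= i\,\dfrac{P(\lambda(t))}{P'(\lambda(t))}$ with $\lambda(t_0)=z_0$. Then the points $z_k=\lambda(t_0+2k\pi)$ for $0\leq k<d$ are distinct. For each $k$, the Newton flow $$\zeta_k'(t) = -\frac{P(\zeta_k(t))}{P'(\zeta_k(t))},\qquad \zeta_k(0)=z_k,$$ is global forward in time (i.e. defined for all $t\geq 0$). The limits $z_k^\ast=\lim_{t\to+\infty}\zeta_k(t)$ exist, they are all the roots of $P$, and this enumeration is consistent with multiplicities, i.e. $$P(z)=(z-z_0^\ast)(z-z_1^\ast)\cdots(z-z_{d-1}^\ast).$$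
   Context: $\mathrm{Crit}(P)=\{z\in\mathbb{C} : P'(z)=0\}$ is the set of critical points of $P$. Arguments are taken modulo $2\pi$; for a set $S\subset\mathbb{C}\setminus\{0\}$, $\arg[S]=\{\arg w : w\in S\}$. If $\mathrm{Crit}(P)$ is empty (only when $d=1$), the maximum is taken to be $0$. *)

theory Defs
  imports "HOL-Analysis.Analysis" "HOL-Computational_Algebra.Polynomial"
begin

definition Crit :: "complex poly \<Rightarrow> complex set" where
  "Crit P = {z. poly (pderiv P) z = 0}"

text \<open>For a nonconstant \<open>P\<close> the set \<open>Crit P\<close> is finite, so \<open>Max\<close> is a genuine maximum.\<close>

definition max_crit_value :: "complex poly \<Rightarrow> real" where
  "max_crit_value P =
     (if Crit P = {} then 0 else Max ((\<lambda>z. cmod (poly P z)) ` Crit P))"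

text \<open>
  Solutions of the autonomous initial value problem \<open>x' = f(x)\<close>, \<open>x(t0) = x0\<close>, on an open
  interval \<open>I\<close>, where the vector field \<open>f\<close> has domain \<open>U\<close>. Functions are total, so the values of
  \<open>f\<close> outside \<open>U\<close> and of \<open>x\<close> outside \<open>I\<close> carry no meaning; in particular \<open>x t \<in> U\<close> is what rules
  out division by zero in the quotients below.
\<close>

definition solves_ivp ::
  "('a::real_normed_vector \<Rightarrow> 'a) \<Rightarrow> 'a set \<Rightarrow> real \<Rightarrow> 'a \<Rightarrow> real set \<Rightarrow> (real \<Rightarrow> 'a) \<Rightarrow> bool" where
  "solves_ivp f U t0 x0 I x \<longleftrightarrow>
     open I \<and> is_interval I \<and> t0 \<in> I \<and> x t0 = x0 \<and>
     (\<forall>t\<in>I. x t \<in> U \<and> (x has_vector_derivative f (x t)) (at t))"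

definition maximal_solution ::
  "('a::real_normed_vector \<Rightarrow> 'a) \<Rightarrow> 'a set \<Rightarrow> real \<Rightarrow> 'a \<Rightarrow> real set \<Rightarrow> (real \<Rightarrow> 'a) \<Rightarrow> bool" where
  "maximal_solution f U t0 x0 I x \<longleftrightarrow>
     solves_ivp f U t0 x0 I x \<and>
     (\<forall>J y. I \<subseteq> J \<and> solves_ivp f U t0 x0 J y \<and> (\<forall>t\<in>I. y t = x t) \<longrightarrow> J = I)"

definition newton_field :: "complex poly \<Rightarrow> complex \<Rightarrow> complex" where
  "newton_field P z = - (poly P z / poly (pderiv P) z)"

definition rotated_newton_field :: "complex poly \<Rightarrow> complex \<Rightarrow> complex" where
  "rotated_newton_field P z = \<i> * (poly P z / poly (pderiv P) z)"

end

theory Submission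
  imports Defs "HOL-Complex_Analysis.Conformal_Mappings"
    "HOL-Computational_Algebra.Fundamental_Theorem_Algebra"
begin

text \<open>
  Along the rotated flow \<open>P\<close> is multiplied by \<open>exp (\<i> t)\<close>, along the Newton flow by \<open>exp (- t)\<close>;
  so both flows are lifts of explicit paths through the covering that \<open>P\<close> induces over the
  complement of its critical values, and the hypotheses on \<open>z0\<close> keep these paths there for all
  times. The path of \<open>lam\<close> extends to a lift \<open>F\<close> of \<open>s \<mapsto> P(z0) exp s\<close> to the half plane
  \<open>Re s \<ge> 0\<close>. If \<open>F\<close> has period \<open>2 \<pi> \<i> m\<close>, compare it for large \<open>Re s\<close> with \<open>exp (s/d)\<close>, which is
  multiplied by \<open>exp (2 \<pi> \<i> m/d)\<close> over this period: this forces \<open>d dvd m\<close>. Hence the \<open>d\<close> points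
  \<open>z k\<close> are distinct, and the Newton trajectories starting there are, at each time \<open>t\<close>, all the
  solutions of \<open>P(z) = exp (- t) P(z0)\<close>. So \<open>P - exp (- t) P(z0)\<close> is the product of the
  \<open>z - \<zeta> k t\<close>, and letting \<open>t\<close> tend to infinity gives the roots with their multiplicities.
\<close>

section \<open>The polynomial as a covering map over its regular values\<close>

lemma finite_Crit:
  assumes "degree P > 0"
  shows "finite (Crit P)"
  using assms poly_roots_finite[of "pderiv P"] by (auto simp: Crit_def pderiv_eq_0_iff)

lemma poly_injective_near_regular_point:
  assumes "a \<notin> Crit P"
  obtains r where "r > 0" "inj_on (poly P) (ball a r)"
proof -
  have "deriv (poly P) a = poly (pderiv P) a"
    by (rule DERIV_imp_deriv) (rule poly_DERIV)
  with assms have "deriv (poly P) a \<noteq> 0"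
    by (simp add: Crit_def)
  moreover have "poly P holomorphic_on UNIV"
    by (intro holomorphic_intros)
  ultimately obtain r where "r > 0" "inj_on (poly P) (ball a r)"
    using has_complex_derivative_locally_injective[of "poly P" UNIV a] by blast
  then show thesis
    by (rule that)
qed

text \<open>A multiple root of \<open>P - [:w:]\<close> would be a critical point with value
  \<open>w\<close>. So all roots are simple, and the factorization has one linear factor per point
  of the fibre.\<close>

lemma regular_fibre:
  fixes P :: "complex poly"
  assumes deg: "degree P > 0" and w: "w \<notin> poly P ` Crit P"
  shows "finite {z. poly P z = w}" and "card {z. poly P z = w} = degree P"
    and "smult (lead_coeff P) (\<Prod>z | poly P z = w. [:-z, 1:]) = P - [:w:]"
proof -
  have roots: "{z. poly (P - [:w:]) z = 0} = {z. poly P z = w}"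
    by auto
  have degw: "degree (P - [:w:]) = degree P"
    unfolding diff_conv_add_uminus using deg by (intro degree_add_eq_left) simp
  then have nz: "P - [:w:] \<noteq> 0"
    using deg by auto
  from poly_roots_finite[OF this] show fin: "finite {z. poly P z = w}"
    by (simp only: roots)
  have lc: "lead_coeff (P - [:w:]) = lead_coeff P"
    using deg degw by (cases "degree P") (auto simp: coeff_pCons)
  have "rsquarefree (P - [:w:])"
    using w by (force simp: rsquarefree_roots Crit_def pderiv_diff pderiv_pCons)
  from complex_poly_decompose_rsquarefree[OF this]
  show dec: "smult (lead_coeff P) (\<Prod>z | poly P z = w. [:-z, 1:]) = P - [:w:]"
    by (simp only: roots lc)
  have "degree (\<Prod>z | poly P z = w. [:-z, 1:]) = card {z. poly P z = w}"
    by (subst degree_prod_eq_sum_degree) auto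
  moreover have "degree (smult (lead_coeff P) (\<Prod>z | poly P z = w. [:-z, 1:])) =
      degree (\<Prod>z | poly P z = w. [:-z, 1:])"
    using deg by (subst degree_smult_eq) auto
  ultimately show "card {z. poly P z = w} = degree P"
    using dec degw by simp
qed

text \<open>The sheets over a neighbourhood of \<open>w\<close> are cut out of disjoint balls around
  the points of the fibre, on each of which \<open>P\<close> is injective. That no sheet is missing
  follows by counting, since all regular fibres have the same size.\<close>

lemma poly_covering_space:
  fixes P :: "complex poly"
  assumes deg: "degree P > 0"
  shows "covering_space {z. poly P z \<notin> poly P ` Crit P} (poly P) (- poly P ` Crit P)"
    (is "covering_space ?C _ ?S")
proof
  show "continuous_on ?C (poly P)"
    by (intro continuous_intros)
  have "\<exists>z. poly P z = w" if "w \<in> ?S" for w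
    using regular_fibre(2)[OF deg, of w] that deg by (metis (mono_tags, lifting) ComplD card.empty empty_Collect_eq less_numeral_extra(3))
  then show "poly P ` ?C = ?S"
    by (auto simp: image_iff) metis
  have opS: "open ?S"
    using finite_Crit[OF deg] by (intro open_Compl finite_imp_closed) auto
  fix w assume w: "w \<in> ?S"
  define A where "A = {z. poly P z = w}"
  have A: "finite A" "card A = degree P"
    using regular_fibre(1,2)[OF deg, of w] w by (auto simp: A_def)
  \<comment> \<open>The radius is at most half the distance to every other point of the fibre, which
    makes the balls disjoint.\<close>
  have "\<exists>r>0. inj_on (poly P) (ball a r) \<and> (\<forall>b\<in>A. b \<noteq> a \<longrightarrow> 2 * r \<le> dist a b)" if "a \<in> A" for a
  proof -
    have "a \<notin> Crit P"
      using that w by (auto simp: A_def)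
    then obtain r where r: "r > 0" "inj_on (poly P) (ball a r)"
      by (rule poly_injective_near_regular_point)
    obtain e where e: "e > 0" "\<forall>b\<in>A. b \<noteq> a \<longrightarrow> e \<le> dist a b"
      using finite_set_avoid[OF A(1), of a] by auto
    show ?thesis
      using r e by (intro exI[of _ "min r (e/2)"]) (auto intro: inj_on_subset)
  qed
  then obtain r where r: "\<And>a. a \<in> A \<Longrightarrow> r a > 0" "\<And>a. a \<in> A \<Longrightarrow> inj_on (poly P) (ball a (r a))"
     "\<And>a b. a \<in> A \<Longrightarrow> b \<in> A \<Longrightarrow> b \<noteq> a \<Longrightarrow> 2 * r a \<le> dist a b"
    by metis
  have disj: "a = b" if "a \<in> A" "b \<in> A" "z \<in> ball a (r a)" "z \<in> ball b (r b)" for a b z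
  proof (rule ccontr)
    assume "a \<noteq> b"
    then have "2 * r a \<le> dist a b" "2 * r b \<le> dist a b"
      using r(3)[of a b] r(3)[of b a] that by (auto simp: dist_commute)
    moreover have "dist a b \<le> dist a z + dist b z"
      by (rule dist_triangle2)
    ultimately show False
      using that by auto
  qed
  \<comment> \<open>Intersecting the images puts a preimage of each point of \<open>T\<close> into
    every ball; \<open>?S\<close> keeps critical values out of \<open>T\<close>, so that the fibre
    count applies there.\<close>
  define T where "T = ?S \<inter> (\<Inter>a\<in>A. poly P ` ball a (r a))"
  define U where "U a = ball a (r a) \<inter> poly P -` T" for a
  have opT: "open T"
    unfolding T_def using A(1) opS r
    by (intro open_Int open_INT ballI open_mapping_thm3) (auto intro!: holomorphic_intros)
  have opU: "open (U a)" for a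
    unfolding U_def by (intro open_Int open_ball open_vimage opT continuous_intros)
  have PU: "poly P ` U a = T" if "a \<in> A" for a
  proof -
    have "T \<subseteq> poly P ` ball a (r a)"
      using that by (auto simp: T_def)
    then show ?thesis
      unfolding U_def by blast
  qed
  \<comment> \<open>Each ball contains a preimage, and there are only \<open>degree P\<close> preimages, so there are no others.\<close>
  have cover: "\<exists>a\<in>A. z \<in> U a" if z: "poly P z \<in> T" for z
  proof -
    have "\<exists>y. y \<in> ball a (r a) \<and> poly P y = poly P z" if "a \<in> A" for a
      using z that by (force simp: T_def)
    then obtain h where h: "\<And>a. a \<in> A \<Longrightarrow> h a \<in> ball a (r a)"
        "\<And>a. a \<in> A \<Longrightarrow> poly P (h a) = poly P z"
      by metis
    have "inj_on h A"
      using disj h(1) by (intro inj_onI) metis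
    then have "card (h ` A) = degree P"
      using A by (simp add: card_image)
    moreover have "poly P z \<notin> poly P ` Crit P"
      using z by (auto simp: T_def)
    ultimately have "h ` A = {y. poly P y = poly P z}"
      using regular_fibre(1,2)[OF deg, of "poly P z"] h(2) by (intro card_subset_eq) auto
    then obtain a where "a \<in> A" "z = h a"
      by blast
    then show ?thesis
      using h(1) z by (auto simp: U_def)
  qed
  show "\<exists>T. w \<in> T \<and> openin (top_of_set ?S) T \<and>
     (\<exists>v. \<Union>v = ?C \<inter> poly P -` T \<and> (\<forall>u \<in> v. openin (top_of_set ?C) u) \<and>
       pairwise disjnt v \<and> (\<forall>u \<in> v. \<exists>q. homeomorphism u T (poly P) q))"
  proof (intro exI[of _ T] exI[of _ "U ` A"] conjI ballI)
    show "w \<in> T"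
      using w r(1) by (auto simp: T_def A_def image_iff intro!: bexI centre_in_ball[THEN iffD2])
    show "openin (top_of_set ?S) T"
      using opT by (intro open_subset) (auto simp: T_def)
    show "\<Union> (U ` A) = ?C \<inter> poly P -` T"
      using cover by (auto simp: U_def T_def)
    show "pairwise disjnt (U ` A)"
      using disj by (fastforce simp: pairwise_def disjnt_def U_def)
    fix u assume "u \<in> U ` A"
    then obtain a where a: "a \<in> A" "u = U a"
      by blast
    show "openin (top_of_set ?C) u"
      using opU a by (intro open_subset) (auto simp: U_def T_def)
    have "inj_on (poly P) u"
      using r(2)[OF a(1)] by (rule inj_on_subset) (auto simp: a U_def)
    moreover have "continuous_on u (poly P)"
      by (intro continuous_intros)
    ultimately obtain q where "homeomorphism u (poly P ` u) (poly P) q"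
      using invariance_of_domain_homeomorphism[of u "poly P"] opU a by auto
    then show "\<exists>q. homeomorphism u T (poly P) q"
      using PU a by auto
  qed
qed

text \<open>Convex sets are simply connected and locally path connected, so the lifting criterion
  applies. The general domain serves both the complex half plane and the real time line.\<close>

lemma poly_lift_convex:
  fixes P :: "complex poly" and g :: "'a::real_normed_vector \<Rightarrow> complex"
  assumes deg: "degree P > 0" and U: "convex U" "u \<in> U"
    and g: "continuous_on U g" "g u = poly P a" "\<And>x. x \<in> U \<Longrightarrow> g x \<notin> poly P ` Crit P"
  obtains f where "continuous_on U f" "f u = a" "\<And>x. x \<in> U \<Longrightarrow> poly P (f x) = g x"
proof -
  have "a \<in> {z. poly P z \<notin> poly P ` Crit P}" "g \<in> U \<rightarrow> - poly P ` Crit P"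
    using g U by (auto simp flip: g(2))
  then show thesis
    using that covering_space_lift_strong[OF poly_covering_space[OF deg] _ U(2)
        convex_imp_simply_connected[OF U(1)] convex_imp_locally_path_connected[OF U(1)] g(1) _ g(2)]
    by (metis (no_types, lifting))
qed

text \<open>The base point \<open>u\<close> is arbitrary, so that two lifts can be compared starting
  from any time at which they meet.\<close>

lemma poly_lift_unique:
  fixes P :: "complex poly" and f g :: "'a::topological_space \<Rightarrow> complex"
  assumes deg: "degree P > 0" and U: "connected U" "u \<in> U" "x \<in> U"
    and f: "continuous_on U f" and g: "continuous_on U g" 
    and fg: "\<And>x. x \<in> U \<Longrightarrow> poly P (f x) = poly P (g x)" "f u = g u"
    and reg: "\<And>x. x \<in> U \<Longrightarrow> poly P (g x) \<notin> poly P ` Crit P"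
  shows "f x = g x"
proof (rule covering_space_lift_unique[where f = "\<lambda>x. poly P (g x)", OF poly_covering_space[OF deg] fg(2) _ _ f _ _ g _ _ U])
  show "continuous_on U (\<lambda>x. poly P (g x))"
    by (intro continuous_intros g)
qed (use fg reg in auto)

section \<open>Flow trajectories as lifts of exponential paths\<close>

lemma has_vector_derivative_exp_affine:
  fixes c w :: complex
  shows "((\<lambda>t. exp (c * of_real (t - t0)) * w) has_vector_derivative
     c * (exp (c * of_real (t - t0)) * w)) (at t)"
proof -
  have "((\<lambda>z. exp (c * (z - of_real t0)) * w) has_field_derivative
      c * (exp (c * (of_real t - of_real t0)) * w)) (at (of_real t))"
    by (auto intro!: derivative_eq_intros)
  from has_vector_derivative_real_field[OF this] show ?thesis
    by simp
qed

text \<open>By the chain rule the denominator cancels, and \<open>y = poly P (x s)\<close> satisfies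
  the linear equation \<open>y' = c * y\<close>. The rotated flow is the case
  \<open>c = \<i>\<close>, the Newton flow the case \<open>c = -1\<close>.\<close>

lemma poly_along_solution:
  fixes c :: complex
  assumes sol: "solves_ivp (\<lambda>z. c * (poly P z / poly (pderiv P) z)) (- Crit P) t0 x0 I x"
    and t: "t \<in> I"
  shows "poly P (x t) = exp (c * of_real (t - t0)) * poly P x0"
proof -
  \<comment> \<open>Multiplication by the integrating factor; the \<open>1\<close> stands for the
    \<open>w\<close> of \<open>has_vector_derivative_exp_affine\<close>.\<close>
  define h where "h = (\<lambda>s. poly P (x s) * (exp (- c * of_real (s - t0)) * 1))"
  have "convex I"
    using sol by (simp add: solves_ivp_def is_interval_convex)
  moreover have "(h has_vector_derivative 0) (at s within I)" if "s \<in> I" for s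
  proof -
    have ne: "poly (pderiv P) (x s) \<noteq> 0" 
      and x: "(x has_vector_derivative c * (poly P (x s) / poly (pderiv P) (x s))) (at s)"
      using sol that by (auto simp: solves_ivp_def Crit_def)
    have "((\<lambda>s. poly P (x s)) has_vector_derivative c * poly P (x s)) (at s)"
      using field_vector_diff_chain_at[OF x poly_DERIV[of P]] ne by (simp add: o_def)
    from has_vector_derivative_mult[OF this has_vector_derivative_exp_affine[of "- c" t0 1]]
    have "(h has_vector_derivative 0) (at s)"
      by (simp add: h_def algebra_simps)
    then show ?thesis
      by (rule has_vector_derivative_at_within)
  qed
  ultimately obtain b where "\<And>s. s \<in> I \<Longrightarrow> h s = b"
    using has_vector_derivative_zero_constant[of I h] by blast
  moreover have "t0 \<in> I" "x t0 = x0"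
    using sol by (auto simp: solves_ivp_def)
  ultimately have "h t = poly P x0"
    using t by (force simp: h_def)
  moreover have "poly P (x t) = exp (c * of_real (t - t0)) * h t"
    by (simp add: h_def exp_minus)
  ultimately show ?thesis
    by simp
qed

text \<open>Near a regular point \<open>P\<close> has a holomorphic inverse \<open>q\<close>. By
  continuity \<open>L\<close> stays in the domain of injectivity for nearby times, so it equals
  \<open>q\<close> composed with the explicit path there, and the chain rule applies.\<close>

lemma lift_has_vector_derivative:
  fixes c :: complex and L :: "real \<Rightarrow> complex"
  assumes L: "continuous_on UNIV L" "\<And>t. poly P (L t) = exp (c * of_real (t - t0)) * w"
    and reg: "L t \<notin> Crit P"
  shows "(L has_vector_derivative c * (poly P (L t) / poly (pderiv P) (L t))) (at t)"
proof -
  define G where "G s = exp (c * of_real (s - t0)) * w" for s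
  obtain r where r: "r > 0" "inj_on (poly P) (ball (L t) r)"
    using poly_injective_near_regular_point[OF reg] by blast
  have hol: "poly P holomorphic_on ball (L t) r"
    by (intro holomorphic_intros)
  obtain q where q: "q holomorphic_on poly P ` ball (L t) r"
      "\<And>z. z \<in> ball (L t) r \<Longrightarrow> deriv (poly P) z * deriv q (poly P z) = 1"
      "\<And>z. z \<in> ball (L t) r \<Longrightarrow> q (poly P z) = z"
    using holomorphic_has_inverse[OF hol open_ball r(2)] by blast
  have "open (poly P ` ball (L t) r)"
    by (rule open_mapping_thm3[OF hol open_ball r(2)])
  moreover have "G t \<in> poly P ` ball (L t) r"
    using r(1) L(2)[of t] by (auto simp: G_def image_iff intro!: bexI[of _ "L t"])
  ultimately have dq: "(q has_field_derivative deriv q (G t)) (at (G t))"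
    using q(1) by (intro holomorphic_derivI)
  have "deriv (poly P) (L t) = poly (pderiv P) (L t)"
    by (rule DERIV_imp_deriv) (rule poly_DERIV)
  then have "poly (pderiv P) (L t) * deriv q (G t) = 1"
    using q(2)[of "L t"] r(1) by (simp add: G_def L(2))
  then have val: "c * G t * deriv q (G t) = c * (poly P (L t) / poly (pderiv P) (L t))"
    using inverse_unique by (fastforce simp: G_def L(2) divide_inverse)
  have "(G has_vector_derivative c * G t) (at t)"
    unfolding G_def by (rule has_vector_derivative_exp_affine)
  from field_vector_diff_chain_at[OF this dq]
  have "((q \<circ> G) has_vector_derivative c * (poly P (L t) / poly (pderiv P) (L t))) (at t)"
    by (simp only: val)
  then show ?thesis
  proof (rule has_vector_derivative_transform_within_open)
    show "open (L -` ball (L t) r)"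
      by (rule open_vimage[OF open_ball L(1)])
    show "(q \<circ> G) s = L s" if "s \<in> L -` ball (L t) r" for s
      using q(3)[of "L s"] that by (simp add: G_def L(2))
  qed (use r in auto)
qed

text \<open>A lift defined for all times cannot be extended further. Conversely, any solution is a
  lift of the same path on its interval, so it agrees with \<open>L\<close> there, and maximality
  forces the interval to be the whole line. Uniqueness of lifts thus replaces a uniqueness theorem
  for differential equations.\<close>

lemma maximal_solution_lift:
  fixes c :: complex and L :: "real \<Rightarrow> complex"
  assumes deg: "degree P > 0"
    and reg: "\<And>t. exp (c * of_real (t - t0)) * poly P x0 \<notin> poly P ` Crit P"
    and L: "continuous_on UNIV L" "L t0 = x0"
      "\<And>t. poly P (L t) = exp (c * of_real (t - t0)) * poly P x0"
  defines "f \<equiv> \<lambda>z. c * (poly P z / poly (pderiv P) z)"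
  shows "maximal_solution f (- Crit P) t0 x0 UNIV L"
    and "maximal_solution f (- Crit P) t0 x0 I x \<Longrightarrow> I = UNIV \<and> x = L"
proof -
  have notcrit: "L t \<notin> Crit P" for t
    using reg[of t] L(3)[of t] by (metis imageI)
  have sol: "solves_ivp f (- Crit P) t0 x0 UNIV L"
    using lift_has_vector_derivative[OF L(1,3) notcrit] notcrit L(2)
    by (auto simp: solves_ivp_def f_def)
  show "maximal_solution f (- Crit P) t0 x0 UNIV L"
    using sol by (auto simp: maximal_solution_def)
  assume max: "maximal_solution f (- Crit P) t0 x0 I x"
  then have x: "solves_ivp f (- Crit P) t0 x0 I x"
    by (simp add: maximal_solution_def)
  have agree: "x t = L t" if "t \<in> I" for t
  proof (rule poly_lift_unique[OF deg, of I t0])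
    show "connected I" "t0 \<in> I" "x t0 = L t0"
      using x L(2) by (auto simp: solves_ivp_def is_interval_connected)
    show "continuous_on I x"
      using x unfolding solves_ivp_def
      by (meson continuous_at_imp_continuous_on has_vector_derivative_continuous)
    show "continuous_on I L"
      using L(1) by (rule continuous_on_subset) simp
  qed (use that reg L(3) poly_along_solution[OF x[unfolded f_def]] in auto)
  then have "UNIV = I"
    using max sol unfolding maximal_solution_def by (metis subset_UNIV)
  then show "I = UNIV \<and> x = L"
    using agree by auto
qed

section \<open>Asymptotics at infinity and periods of the lift\<close>

text \<open>Since \<open>P(z) / z^d\<close> tends to 1, \<open>F s\<close> is
  \<open>exp (s / d)\<close> times a \<open>d\<close>-th root of \<open>w\<close>, up to a
  correction depending only on the value \<open>F s\<close>. Over a period the correction returns to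
  itself, so \<open>exp (s / d)\<close> must do so too.\<close>

lemma period_dvd_degree:
  fixes P :: "complex poly" and F :: "complex \<Rightarrow> complex"
  assumes monic: "lead_coeff P = 1" and deg: "degree P > 0" and w: "w \<noteq> 0"
    and F: "continuous_on {s. Re s \<ge> 0} F" "\<And>s. Re s \<ge> 0 \<Longrightarrow> poly P (F s) = exp s * w"
    and per: "\<And>s. Re s \<ge> 0 \<Longrightarrow> F (s + of_real (2 * real m * pi) * \<i>) = F s"
  shows "degree P dvd m"
proof -
  define d where "d = degree P"
  have d: "d > 0"
    using deg by (simp add: d_def)
  have "((\<lambda>z. poly P z / z ^ d) \<longlongrightarrow> 1) at_infinity"
    using poly_divide_tendsto_aux[of P] monic by (simp add: d_def)
  then have "eventually (\<lambda>z. dist (poly P z / z ^ d) 1 < 1) at_infinity"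
    by (rule tendstoD) simp
  then obtain B where B: "\<And>z. norm z \<ge> B \<Longrightarrow> dist (poly P z / z ^ d) 1 < 1"
    by (auto simp: eventually_at_infinity)
  have "compact (poly P ` cball 0 \<bar>B\<bar>)"
    by (intro compact_continuous_image continuous_intros) simp
  then obtain K where K: "\<And>z. norm z \<le> \<bar>B\<bar> \<Longrightarrow> norm (poly P z) \<le> K"
    by (force dest: compact_imp_bounded simp: bounded_iff)
  \<comment> \<open>Chosen so that \<open>exp s * w\<close> exceeds in modulus every value of
    \<open>P\<close> on the disc of radius \<open>\<bar>B\<bar>\<close>. \<open>max K 1\<close>
    keeps the argument of \<open>ln\<close> positive, the summand 1 makes the inequality strict, and
    \<open>max 0\<close> stays in the domain of \<open>F\<close>.\<close>
  define A where "A = max 0 (ln (max K 1 / norm w) + 1)"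
  have large: "norm (F s) > \<bar>B\<bar>" if "Re s \<ge> A" for s
  proof (rule ccontr)
    assume "\<not> norm (F s) > \<bar>B\<bar>"
    then have "norm (poly P (F s)) \<le> K"
      by (intro K) simp
    moreover have "norm (poly P (F s)) = exp (Re s) * norm w"
      using F(2)[of s] that by (simp add: A_def norm_mult)
    moreover have "exp (Re s) > exp (ln (max K 1 / norm w))"
      using that by (simp add: A_def)
    then have "exp (Re s) * norm w > max K 1"
      using w by (simp add: field_simps exp_ln)
    ultimately show False
      by simp
  qed
  define Q where "Q s = poly P (F s) / F s ^ d" for s
  \<comment> \<open>A continuous branch of the \<open>d\<close>-th root of \<open>exp (- s) * poly P (F s) = w\<close>, hence constant.\<close>
  define k where "k s = F s * exp (- s / of_nat d) * exp (Ln (Q s) / of_nat d)" for s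
  define H where "H = {s. Re s \<ge> A}"
  have H: "Re s \<ge> 0" "F s \<noteq> 0" "0 < Re (Q s)" if "s \<in> H" for s
  proof -
    show "Re s \<ge> 0"
      using that by (simp add: H_def A_def)
    have "norm (F s) > \<bar>B\<bar>"
      using large that by (simp add: H_def)
    then show "F s \<noteq> 0"
      by auto
    \<comment> \<open>The open unit disc around 1 lies in the right half plane, where
      \<open>Ln\<close> is continuous.\<close>
    have "dist (Q s) 1 < 1"
      unfolding Q_def using \<open>norm (F s) > \<bar>B\<bar>\<close> by (intro B) simp
    then have "\<bar>Re (Q s - 1)\<bar> < 1"
      using abs_Re_le_cmod[of "Q s - 1"] by (simp add: dist_norm)
    then show "0 < Re (Q s)"
      by simp
  qed
  have contF: "continuous_on H F"
    using F(1) by (rule continuous_on_subset) (use H in auto)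
  have "continuous_on H k"
    unfolding k_def Q_def using H d
    by (intro continuous_intros contF) (force simp: Q_def complex_nonpos_Reals_iff)+
  moreover have "connected H"
    unfolding H_def by (intro convex_connected convex_halfspace_Re_ge)
  moreover have "k s ^ d = w" if "s \<in> H" for s
  proof -
    have "Q s \<noteq> 0"
      using H(3)[OF that] by auto
    then have "exp (Ln (Q s) / of_nat d) ^ d = Q s"
      using d by (simp add: exp_of_nat_mult [symmetric])
    moreover have "exp (- s / of_nat d) ^ d = exp (- s)"
      using d by (simp add: exp_of_nat_mult [symmetric])
    ultimately have "k s ^ d = F s ^ d * exp (- s) * Q s"
      by (simp add: k_def power_mult_distrib)
    also have "\<dots> = exp (- s) * poly P (F s)"
      using H(2)[OF that] by (simp add: Q_def)
    also have "\<dots> = w"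
      using F(2)[of s] H(1)[OF that] by (simp add: exp_minus)
    finally show ?thesis .
  qed
  then have "k ` H \<subseteq> {z. z ^ d = w}"
    by auto
  then have "finite (k ` H)"
    using finite_nth_roots[OF d] by (rule finite_subset)
  ultimately have "k constant_on H"
    by (intro continuous_finite_range_constant)
  define s0 s1 where "s0 = complex_of_real A" and "s1 = s0 + of_real (2 * real m * pi) * \<i>"
  have s01: "s0 \<in> H" "s1 \<in> H"
    by (auto simp: s0_def s1_def H_def)
  then have "k s1 = k s0"
    using \<open>k constant_on H\<close> by (auto simp: constant_on_def)
  moreover have "F s1 = F s0"
    unfolding s1_def using H(1)[OF s01(1)] by (rule per)
  moreover from this have "Q s1 = Q s0"
    using F(2)[of s1] F(2)[of s0] H(1) s01 by (simp add: Q_def)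
  \<comment> \<open>The other two factors of \<open>k\<close> agree at \<open>s0\<close> and
    \<open>s1\<close> and are nonzero, so they cancel.\<close>
  ultimately have "exp (- s1 / of_nat d) = exp (- s0 / of_nat d)"
    using H(2)[OF s01(1)] by (simp add: k_def)
  then have "exp (s0 / of_nat d - s1 / of_nat d) = 1"
    by (simp add: exp_diff exp_minus field_simps)
  then obtain n :: int where "Im (s0 / of_nat d - s1 / of_nat d) = of_int (2 * n) * pi"
    by (auto simp: exp_eq_1)
  then have "pi * (real m + of_int n * real d) = 0"
    using d by (simp add: s1_def field_simps)
  then have "real m + of_int n * real d = 0"
    by simp
  then have "real_of_int (int m) = real_of_int (int d * (- n))"
    by (simp add: algebra_simps)
  then have "int m = int d * (- n)"
    by (simp only: of_int_eq_iff)
  then show ?thesis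
    unfolding d_def by (metis dvd_triv_left int_dvd_int_iff)
qed

section \<open>Convergence of paths to roots\<close>

text \<open>Small values of \<open>P\<close> occur only near its finitely many roots. A continuous
  path that ends up in a union of disjoint balls around them has to stay in one of these
  balls.\<close>

lemma tendsto_at_top_if_poly_tendsto_0:
  fixes P :: "complex poly" and f :: "real \<Rightarrow> complex"
  assumes nz: "P \<noteq> 0" and f: "continuous_on UNIV f"
    and lim: "((\<lambda>t. poly P (f t)) \<longlongrightarrow> 0) at_top"
  shows "\<exists>r. (f \<longlongrightarrow> r) at_top"
proof -
  define A where "A = {z. poly P z = 0}"
  have A: "finite A"
    using poly_roots_finite[OF nz] by (simp add: A_def)
  have near: "eventually (\<lambda>t. \<exists>r\<in>A. dist r (f t) < e) at_top" if e: "e > 0" for e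
  proof -
    \<comment> \<open>By the factorization of \<open>P\<close>, a lower bound for its modulus at
      points at distance at least \<open>e\<close> from all roots.\<close>
    define b where "b = norm (lead_coeff P) * (\<Prod>r\<in>A. e ^ order r P)"
    have "b > 0"
      using nz e by (auto simp: b_def intro!: mult_pos_pos prod_pos)
    then have "eventually (\<lambda>t. dist (poly P (f t)) 0 < b) at_top"
      using lim by (intro tendstoD)
    then show ?thesis
    proof eventually_elim
      case (elim t)
      show ?case
      proof (rule ccontr)
        assume far: "\<not> (\<exists>r\<in>A. dist r (f t) < e)"
        have "poly P (f t) = lead_coeff P * (\<Prod>r\<in>A. (f t - r) ^ order r P)"
          by (subst complex_poly_decompose[symmetric]) (simp add: poly_prod A_def)
        then have "norm (poly P (f t)) = norm (lead_coeff P) * (\<Prod>r\<in>A. norm (f t - r) ^ order r P)"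
          by (simp add: norm_mult prod_norm[symmetric] norm_power)
        also have "\<dots> \<ge> b"
          unfolding b_def using far e
          by (intro mult_left_mono prod_mono conjI power_mono) (auto simp: dist_norm norm_minus_commute not_less)
        finally show False
          using elim by simp
      qed
    qed
  qed
  have "\<exists>e>0. \<forall>r\<in>A. \<forall>s\<in>A. r \<noteq> s \<longrightarrow> e \<le> dist r s"
    using A uniform_discrete_finite_iff[of A] by (auto simp: uniform_discrete_def) (meson not_less)
  then obtain e where e: "e > 0" "\<And>r s. r \<in> A \<Longrightarrow> s \<in> A \<Longrightarrow> r \<noteq> s \<Longrightarrow> 2 * e \<le> dist r s"
    by (metis field_sum_of_halves half_gt_zero mult_2)
  have disj: "r = s" if "r \<in> A" "s \<in> A" "z \<in> ball r e" "z \<in> ball s e" for r s z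
    using e(2)[of r s] that dist_triangle2[of r s z] by fastforce
  obtain T where T: "\<And>t. t \<ge> T \<Longrightarrow> \<exists>r\<in>A. dist r (f t) < e"
    using near[OF e(1)] by (auto simp: eventually_at_top_linorder)
  then obtain r where r: "r \<in> A" "f T \<in> ball r e"
    by auto
  have conn: "connected (f ` {T..})"
    using f by (intro connected_continuous_image) (auto intro: continuous_on_subset)
  have stay: "f t \<in> ball r e" if "t \<ge> T" for t
  proof (rule ccontr)
    define V where "V = (\<Union>s\<in>A - {r}. ball s e)"
    assume "f t \<notin> ball r e"
    then have "f t \<in> V"
      using T[OF that] by (auto simp: V_def)
    then have "V \<inter> f ` {T..} \<noteq> {}"
      using that by blast
    moreover have "ball r e \<inter> f ` {T..} \<noteq> {}"
      using r by auto
    moreover have "ball r e \<inter> V \<inter> f ` {T..} = {}"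
      using disj r(1) by (auto simp: V_def simp del: mem_ball)
    moreover have "f ` {T..} \<subseteq> ball r e \<union> V"
      using T by (force simp: V_def)
    ultimately show False
      using connectedD[OF conn, of "ball r e" V] by (auto simp: V_def)
  qed
  have "(f \<longlongrightarrow> r) at_top"
  proof (rule tendstoI)
    fix e' :: real assume "e' > 0"
    \<comment> \<open>Closeness within \<open>e\<close> identifies the root as \<open>r\<close>;
      closeness within \<open>e'\<close> is what the limit asks for.\<close>
    then have "eventually (\<lambda>t. \<exists>s\<in>A. dist s (f t) < min e e') at_top"
      using e(1) by (intro near) simp
    then show "eventually (\<lambda>t. dist (f t) r < e') at_top"
      using eventually_ge_at_top[of T]
    proof eventually_elim
      case (elim t)
      then obtain s where "s \<in> A" "dist s (f t) < min e e'"
        by blast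
      moreover from this have "s = r"
        using disj[of s r "f t"] r(1) stay[OF elim(2)] by simp
      ultimately show ?case
        by (simp add: dist_commute)
    qed
  qed
  then show ?thesis
    by blast
qed

section \<open>Critical values and the two flows from \<open>z0\<close>\<close>

lemma cmod_le_max_crit_value:
  assumes "degree P > 0" "v \<in> poly P ` Crit P"
  shows "cmod v \<le> max_crit_value P"
  using assms finite_Crit[of P] by (auto simp: max_crit_value_def intro!: Max_ge)

text \<open>This turns the modulus hypothesis into \<open>P(z0) \<noteq> 0\<close>, also when there
  are no critical points and the default value 0 is used.\<close>

lemma max_crit_value_nonneg:
  assumes "degree P > 0"
  shows "0 \<le> max_crit_value P"
proof (cases "Crit P = {}")
  case False
  then obtain z where "z \<in> Crit P"
    by blast
  then have "cmod (poly P z) \<le> max_crit_value P"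
    using assms by (intro cmod_le_max_crit_value) auto
  then show ?thesis
    using norm_ge_zero order_trans by blast
qed (simp add: max_crit_value_def)

theorem theorem4:
  fixes P :: "complex poly" and d :: nat and z0 :: complex and t0 :: real
    and I :: "real set" and lam :: "real \<Rightarrow> complex"
  assumes monic: "lead_coeff P = 1"
    and deg: "degree P = d" "d \<ge> 1"
    and modulus: "cmod (poly P z0) > max_crit_value P"
    and argument: "Arg (poly P z0) \<notin> Arg ` (poly P ` Crit P - {0})"
    and lam_sol: "maximal_solution (rotated_newton_field P) (- Crit P) t0 z0 I lam"
  shows "(\<forall>k<d. t0 + 2 * real k * pi \<in> I) \<and>
    inj_on (\<lambda>k. lam (t0 + 2 * real k * pi)) {..<d} \<and>
    (\<forall>k<d. \<exists>J \<zeta>. maximal_solution (newton_field P) (- Crit P) 0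
                    (lam (t0 + 2 * real k * pi)) J \<zeta>) \<and>
    (\<exists>zlim :: nat \<Rightarrow> complex.
       (\<forall>k<d. \<forall>J \<zeta>. maximal_solution (newton_field P) (- Crit P) 0
                        (lam (t0 + 2 * real k * pi)) J \<zeta> \<longrightarrow>
                      {0..} \<subseteq> J \<and> (\<zeta> \<longlongrightarrow> zlim k) at_top) \<and>
       zlim ` {..<d} = {z. poly P z = 0} \<and>
       P = (\<Prod>k<d. [:- zlim k, 1:]))"
proof -
  have degP: "degree P > 0"
    using deg by simp
  define w where "w = poly P z0"
  have w: "w \<noteq> 0"
    using modulus max_crit_value_nonneg[OF degP] by (auto simp: w_def)
  \<comment> \<open>On the half plane the modulus is at least that of \<open>w\<close>, which
    exceeds all critical values.\<close>
  have exterior: "exp s * w \<notin> poly P ` Crit P" if "Re s \<ge> 0" for s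
  proof
    assume "exp s * w \<in> poly P ` Crit P"
    from cmod_le_max_crit_value[OF degP this]
    have "exp (Re s) * cmod w \<le> max_crit_value P"
      by (simp add: norm_mult)
    moreover have "1 * cmod w \<le> exp (Re s) * cmod w"
      using that by (intro mult_right_mono) auto
    ultimately show False
      using modulus by (simp add: w_def)
  qed
  \<comment> \<open>Positive multiples of \<open>w\<close> keep its argument and are nonzero, so a
    critical value 0, coming from a multiple root, is never met. The exponent has the form of
    \<open>maximal_solution_lift\<close> with \<open>c = -1\<close> and initial time 0.\<close>
  have ray: "exp (- 1 * of_real (t - 0)) * w \<notin> poly P ` Crit P" for t
  proof
    assume crit: "exp (- 1 * of_real (t - 0)) * w \<in> poly P ` Crit P"
    have "exp (- 1 * of_real (t - 0)) * w = of_real (exp (- t)) * w"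
      by (simp add: exp_of_real[symmetric])
    then have "Arg (exp (- 1 * of_real (t - 0)) * w) = Arg w"
      by (metis Arg_times_of_real exp_gt_zero)
    moreover have "exp (- 1 * of_real (t - 0)) * w \<in> poly P ` Crit P - {0}"
      using crit w by simp
    ultimately have "Arg w \<in> Arg ` (poly P ` Crit P - {0})"
      by (metis imageI)
    then show False
      using argument by (simp add: w_def)
  qed

  define H where "H = {s. Re s \<ge> 0}"
  have H: "convex H" "0 \<in> H"
    by (simp_all add: H_def convex_halfspace_Re_ge)
  obtain F where F: "continuous_on H F" "F 0 = z0" "\<And>s. s \<in> H \<Longrightarrow> poly P (F s) = exp s * w"
  proof (rule poly_lift_convex[OF degP H, of "\<lambda>s. exp s * w" z0])
    show "continuous_on H (\<lambda>s. exp s * w)"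
      by (intro continuous_intros)
  qed (use exterior in \<open>auto simp: w_def H_def\<close>)
  define L where "L t = F (\<i> * of_real (t - t0))" for t
  have contL: "continuous_on UNIV L"
    unfolding L_def
    by (rule continuous_on_compose2[OF F(1)]) (auto intro!: continuous_intros simp: H_def)
  have PL: "poly P (L t) = exp (\<i> * of_real (t - t0)) * poly P z0" for t
    by (simp add: L_def F(3) H_def w_def)
  have "I = UNIV \<and> lam = L"
  proof (rule maximal_solution_lift(2)[OF degP _ contL _ PL])
    show "exp (\<i> * of_real (t - t0)) * poly P z0 \<notin> poly P ` Crit P" for t
      using exterior[of "\<i> * of_real (t - t0)"] by (simp add: w_def)
    show "L t0 = z0"
      by (simp add: L_def F)
    show "maximal_solution (\<lambda>z. \<i> * (poly P z / poly (pderiv P) z)) (- Crit P) t0 z0 I lam"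
      using lam_sol by (simp add: rotated_newton_field_def[abs_def])
  qed
  then have I: "I = UNIV" and lam: "lam = L"
    by auto

  define z where "z k = lam (t0 + 2 * real k * pi)" for k
  have zF: "z k = F (of_real (2 * real k * pi) * \<i>)" for k
    by (simp add: z_def lam L_def mult.commute)
  have Pz: "poly P (z k) = w" for k
    using exp_integer_2pi[of "of_nat k"]
    by (simp add: zF F(3) H_def)
  have shift: "s + of_real (2 * real k * pi) * \<i> \<in> H \<longleftrightarrow> s \<in> H" for s k
    by (simp add: H_def)
  have exp_shift: "exp (s + of_real (2 * real k * pi) * \<i>) = exp s" for s k
    using exp_integer_2pi[of "of_nat k"] by (simp add: exp_add mult_ac)
  \<comment> \<open>A coincidence at \<open>s = 0\<close> makes two translates of \<open>F\<close>
    agree on all of \<open>H\<close>. Shifting back along the imaginary direction, which preserves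
    \<open>H\<close>, gives the period belonging to \<open>k - j\<close>, a positive number below
    \<open>d\<close>.\<close>
  have "z j \<noteq> z k" if "j < k" "k < d" for j k
  proof
    assume eq: "z j = z k"
    have F_shift: "continuous_on H (\<lambda>s. F (s + of_real (2 * real k * pi) * \<i>))" for k
      by (rule continuous_on_compose2[OF F(1)]) (auto intro!: continuous_intros simp: H_def)
    have per: "F (s + of_real (2 * real j * pi) * \<i>) = F (s + of_real (2 * real k * pi) * \<i>)" if "s \<in> H" for s
      by (rule poly_lift_unique[OF degP convex_connected[OF H(1)] H(2) that F_shift F_shift])
         (use eq exterior F(3) shift exp_shift in \<open>auto simp: zF H_def\<close>)
    have "degree P dvd k - j"
    proof (rule period_dvd_degree[OF monic degP w])
      show "F (s + of_real (2 * real (k - j) * pi) * \<i>) = F s" if "Re s \<ge> 0" for s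
      proof -
        have "s - of_real (2 * real j * pi) * \<i> \<in> H"
          using that by (simp add: H_def)
        from per[OF this] show ?thesis
          using \<open>j < k\<close> by (simp add: of_nat_diff algebra_simps)
      qed
    qed (use F in \<open>auto simp: H_def\<close>)
    then show False
      using that deg by (auto dest: dvd_imp_le)
  qed
  then have inj: "inj_on z {..<d}"
    by (intro linorder_inj_onI) auto

  have "\<exists>Z. continuous_on UNIV Z \<and> Z 0 = z k \<and>
      (\<forall>t. poly P (Z t) = exp (- 1 * of_real (t - 0)) * poly P (z k))" for k
  proof (rule poly_lift_convex[OF degP, of UNIV "0::real" "\<lambda>t. exp (- 1 * of_real (t - 0)) * poly P (z k)" "z k"])
    show "continuous_on UNIV (\<lambda>t. exp (- 1 * of_real (t - 0)) * poly P (z k))"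
      by (intro continuous_intros)
  qed (use ray in \<open>auto simp: Pz\<close>)
  then obtain Z where Z: "\<And>k. continuous_on UNIV (Z k)" "\<And>k. Z k 0 = z k"
      "\<And>k t. poly P (Z k t) = exp (- 1 * of_real (t - 0)) * poly P (z k)"
    by metis
  have newton: "newton_field P = (\<lambda>z. - 1 * (poly P z / poly (pderiv P) z))"
    by (simp add: newton_field_def fun_eq_iff)
  have maxZ: "maximal_solution (newton_field P) (- Crit P) 0 (z k) UNIV (Z k)" for k
    unfolding newton using ray by (intro maximal_solution_lift(1)[OF degP _ Z]) (simp add: Pz)
  have uniqueZ: "J = UNIV \<and> \<zeta> = Z k" 
    if "maximal_solution (newton_field P) (- Crit P) 0 (z k) J \<zeta>" for k J \<zeta>
    using ray that unfolding newton
    by (intro maximal_solution_lift(2)[OF degP _ Z]) (simp_all add: Pz)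

  have "inj_on (\<lambda>k. Z k t) {..<d}" for t
  proof (rule inj_onI)
    fix j k assume jk: "j \<in> {..<d}" "k \<in> {..<d}" "Z j t = Z k t"
    \<comment> \<open>Trajectories that meet at time \<open>t\<close> are lifts of the same path
      with a common point, so they already agree at time 0.\<close>
    have "Z j 0 = Z k 0"
      by (rule poly_lift_unique[OF degP connected_UNIV UNIV_I[of t] UNIV_I Z(1) Z(1) _ jk(3)])
         (use Z(3) ray in \<open>simp_all add: Pz\<close>)
    then show "j = k"
      using inj jk Z(2) by (auto dest: inj_onD)
  qed
  then have decomp: "P - [:exp (- of_real t) * w:] = (\<Prod>k<d. [:- Z k t, 1:])" for t
  proof -
    let ?c = "exp (- of_real t) * w"
    have c: "?c \<notin> poly P ` Crit P"
      using ray[of t] by simp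
    \<comment> \<open>These are \<open>d\<close> distinct points in a fibre of \<open>d\<close>
      points, hence all of it.\<close>
    have "(\<lambda>k. Z k t) ` {..<d} = {z. poly P z = ?c}"
      using regular_fibre(1,2)[OF degP c] deg \<open>inj_on (\<lambda>k. Z k t) {..<d}\<close>
      by (intro card_subset_eq) (auto simp: Z(3) Pz card_image)
    moreover have "P - [:?c:] = (\<Prod>z | poly P z = ?c. [:-z, 1:])"
      using regular_fibre(3)[OF degP c] monic by simp
    ultimately show ?thesis
      using prod.reindex[OF \<open>inj_on (\<lambda>k. Z k t) {..<d}\<close>, of "\<lambda>z. [:-z, 1:]"] by (simp add: o_def)
  qed

  have decay: "((\<lambda>t. exp (- complex_of_real t) * w) \<longlongrightarrow> 0) at_top"
  proof -
    have "((\<lambda>t::real. exp (- t)) \<longlongrightarrow> 0) at_top"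
      by (rule filterlim_compose[OF exp_at_bot filterlim_uminus_at_bot_at_top])
    then have "((\<lambda>t. of_real (exp (- t)) * w) \<longlongrightarrow> of_real 0 * w) at_top"
      by (intro tendsto_intros)
    then show ?thesis
      by (simp add: exp_of_real[symmetric])
  qed
  have "\<exists>r. (Z k \<longlongrightarrow> r) at_top" for k
    using degP Z(1) decay by (intro tendsto_at_top_if_poly_tendsto_0[of P]) (auto simp: Z(3) Pz)
  then obtain zlim where zlim: "\<And>k. (Z k \<longlongrightarrow> zlim k) at_top"
    by metis
  \<comment> \<open>The limit is taken at each fixed \<open>x\<close>. Trajectories with the same
    limit just repeat a factor, which accounts for the multiplicities.\<close>
  have fact: "P = (\<Prod>k<d. [:- zlim k, 1:])"
  proof (rule poly_eq_poly_eq_iff[THEN iffD1, OF ext])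
    fix x
    have "((\<lambda>t. poly P x - exp (- of_real t) * w) \<longlongrightarrow> poly P x - 0) at_top"
      by (intro tendsto_intros decay)
    moreover have "poly P x - exp (- of_real t) * w = (\<Prod>k<d. x - Z k t)" for t
      using arg_cong[OF decomp[of t], of "\<lambda>p. poly p x"] by (simp add: poly_prod)
    moreover have "((\<lambda>t. \<Prod>k<d. x - Z k t) \<longlongrightarrow> (\<Prod>k<d. x - zlim k)) at_top"
      by (intro tendsto_intros zlim)
    ultimately show "poly P x = poly (\<Prod>k<d. [:- zlim k, 1:]) x"
      using tendsto_unique[OF trivial_limit_at_top_linorder] by (fastforce simp: poly_prod)
  qed
  have "zlim ` {..<d} = {x. poly P x = 0}"
    by (subst fact) (auto simp: poly_prod)
  moreover have "\<forall>k<d. \<forall>J \<zeta>. maximal_solution (newton_field P) (- Crit P) 0 (z k) J \<zeta> \<longrightarrow>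
      {0..} \<subseteq> J \<and> (\<zeta> \<longlongrightarrow> zlim k) at_top"
    using uniqueZ zlim by blast
  ultimately show ?thesis
    using I inj maxZ fact unfolding z_def[abs_def] by blast
qed

end
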